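(* Let $P[x]$ and $Q[x]$ be polynomials in $n$ variables with real coefficients such that $Q[x]=\sum_{|\alpha|\le N}b_\alpha x^\alpha\neq0$ for all $x\in[0,\infty)^n$ and all the coefficients of $Q$ have the same sign. Then $$\frac{P[x_1^2,\ldots,x_n^2]}{Q[x_1^2,\ldots,x_n^2]}\in\mathcal{O}.$$
   Context: Multi-indices are elements $k=(k_1,\ldots,k_n)\in\mathbb{N}_0^n$, with $|k|=k_1+\cdots+k_n$; $x^\alpha=x_1^{\alpha_1}\cdots x_n^{\alpha_n}$; $\|x\|=(x_1^2+\cdots+x_n^2)^{1/2}$. "All coefficients have the same sign" means that either $b_\alpha\ge0$ for all $\alpha$ or $b_\alpha\le0$ for all $\alpha$ (zero coefficients are allowed). Let $T_i=x_i^{-1}\frac{\partial}{\partial x_i}$ and $T^k=T_n^{k_n}\circ\cdots\circ T_1^{k_1}$. $\mathcal{O}$ is the space of functions $\theta\in C^\infty((0,\infty)^n)$ such that for every $k\in\mathbb{N}_0^n$ there exist $n_k\in\mathbb{Z}$ and $C>0$ with $$|(1+\|x\|^2)^{n_k}\,T^k\theta(x)|<C\qquad\text{for all }x\in(0,\infty)^n.$$ *)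

theory Defs
  imports "HOL-Analysis.Analysis" "HOL-Library.Poly_Mapping"
begin

text \<open>
  The index type \<open>'n\<close> stands for \<open>{1,\<dots>,n}\<close>.  The polynomial ring over \<open>'a\<close> in variables indexed
  by \<open>'n\<close> is the monoid algebra of the exponents \<open>'n \<Rightarrow>\<^sub>0 nat\<close>; \<open>Poly_Mapping.lookup P \<alpha>\<close> is the coefficient of
  \<open>x\<^sup>\<alpha>\<close> in \<open>P\<close>.
\<close>

type_synonym ('n, 'a) mpoly = "('n \<Rightarrow>\<^sub>0 nat) \<Rightarrow>\<^sub>0 'a"

definition monomial_eval :: "('n::finite \<Rightarrow>\<^sub>0 nat) \<Rightarrow> real^'n \<Rightarrow> real" where
  "monomial_eval \<alpha> x = (\<Prod>i\<in>UNIV. (x $ i) ^ Poly_Mapping.lookup \<alpha> i)"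

definition mpoly_eval :: "('n::finite, real) mpoly \<Rightarrow> real^'n \<Rightarrow> real" where
  "mpoly_eval P x = (\<Sum>\<alpha>\<in>Poly_Mapping.keys P. Poly_Mapping.lookup P \<alpha> * monomial_eval \<alpha> x)"

definition closed_orthant :: "(real^'n) set" where
  "closed_orthant = {x. \<forall>i. 0 \<le> x $ i}"

definition open_orthant :: "(real^'n) set" where
  "open_orthant = {x. \<forall>i. 0 < x $ i}"

definition partial_deriv :: "'n::finite \<Rightarrow> (real^'n \<Rightarrow> real) \<Rightarrow> real^'n \<Rightarrow> real" where
  "partial_deriv i f x = deriv (\<lambda>t. f (x + t *\<^sub>R axis i 1)) 0"

text \<open>
  \<open>Ck_on m S f\<close> is meant for open \<open>S\<close>: all iterated partial derivatives of \<open>f\<close> of order at most \<open>m\<close>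
  exist and are continuous on \<open>S\<close>.  Values of \<open>f\<close> outside \<open>S\<close> are then irrelevant.
\<close>

primrec Ck_on :: "nat \<Rightarrow> (real^'n::finite) set \<Rightarrow> (real^'n \<Rightarrow> real) \<Rightarrow> bool" where
  "Ck_on 0 S f \<longleftrightarrow> continuous_on S f"
| "Ck_on (Suc m) S f \<longleftrightarrow> continuous_on S f \<and>
     (\<forall>i. (\<forall>x\<in>S. (\<lambda>t. f (x + t *\<^sub>R axis i 1)) field_differentiable (at 0)) \<and>
          Ck_on m S (partial_deriv i f))"

definition Cinfinity_on :: "(real^'n::finite) set \<Rightarrow> (real^'n \<Rightarrow> real) \<Rightarrow> bool" where
  "Cinfinity_on S f \<longleftrightarrow> (\<forall>m. Ck_on m S f)"

definition T_op :: "'n::finite \<Rightarrow> (real^'n \<Rightarrow> real) \<Rightarrow> real^'n \<Rightarrow> real" where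
  "T_op i f x = inverse (x $ i) * partial_deriv i f x"

text \<open>
  \<open>fold\<close> applies the operator of the first list element first, so with the indices listed as
  \<open>i\<^sub>1 < \<dots> < i\<^sub>n\<close> this is the composition \<open>T\<^sub>n^k\<^sub>n \<circ> \<dots> \<circ> T\<^sub>1^k\<^sub>1\<close>.
\<close>

definition T_pow :: "('n \<Rightarrow> nat) \<Rightarrow>
    (real^'n::{finite,linorder} \<Rightarrow> real) \<Rightarrow> real^'n::{finite,linorder} \<Rightarrow> real" where
  "T_pow k f = fold (\<lambda>i. T_op i ^^ k i) (sorted_list_of_set UNIV) f"

text \<open>
  Functions on the open orthant are represented by total functions with arbitrary values elsewhere.
\<close>

definition space_O :: "(real^'n::{finite,linorder} \<Rightarrow> real) set" where
  "space_O = {\<theta>. Cinfinity_on open_orthant \<theta> \<and>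
     (\<forall>k::'n \<Rightarrow> nat. \<exists>(nk::int) (C::real). C > 0 \<and>
        (\<forall>x\<in>open_orthant. \<bar>(1 + (norm x)\<^sup>2) powi nk * T_pow k \<theta> x\<bar> < C))}"

definition same_sign_coeffs :: "('n, real) mpoly \<Rightarrow> bool" where
  "same_sign_coeffs Q \<longleftrightarrow> (\<forall>\<alpha>. Poly_Mapping.lookup Q \<alpha> \<ge> 0) \<or> (\<forall>\<alpha>. Poly_Mapping.lookup Q \<alpha> \<le> 0)"

definition square_args :: "real^'n \<Rightarrow> real^'n" where
  "square_args x = (\<chi> i. (x $ i)\<^sup>2)"

end

(*
  Under the sign hypothesis, all terms of Q have the same sign on the orthant, so |Q| is bounded below
  there by its constant term |Q(0)| > 0. Hence g(x) = 1/Q(x_1^2,...,x_n^2) is bounded. Since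
  T_i x_j^2 = 2 if i = j, and 0 otherwise, and T_i g = - T_i(1/g) g^2, the algebra of functions
  generated by the constants, the x_j^2 and g is stable under every T_i, and all its elements have
  polynomial growth. Smoothness is the same argument with the partial derivatives in place of the T_i
  and the x_j in place of the x_j^2.
*)
theory Submission
  imports Defs
begin

section \<open>Algebras of functions stable under a derivation\<close>

text \<open>The unital real algebra generated by \<open>G\<close>. Being inductive, it lets
  continuity, growth and stability pass from the generators to all elements.\<close>

inductive_set gen_algebra :: "('a \<Rightarrow> real) set \<Rightarrow> ('a \<Rightarrow> real) set"
  for G :: "('a \<Rightarrow> real) set" where
  gen: "f \<in> G \<Longrightarrow> f \<in> gen_algebra G"
| const: "(\<lambda>x. c) \<in> gen_algebra G"
| add: "f \<in> gen_algebra G \<Longrightarrow> h \<in> gen_algebra G \<Longrightarrow> (\<lambda>x. f x + h x) \<in> gen_algebra G"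
| mult: "f \<in> gen_algebra G \<Longrightarrow> h \<in> gen_algebra G \<Longrightarrow> (\<lambda>x. f x * h x) \<in> gen_algebra G"

lemma gen_algebra_mono:
  assumes "f \<in> gen_algebra G" "G \<subseteq> H"
  shows "f \<in> gen_algebra H"
  using assms(1) by induction (use assms(2) in \<open>auto intro: gen_algebra.intros\<close>)

lemma gen_algebra_sum:
  assumes "\<And>a. a \<in> A \<Longrightarrow> f a \<in> gen_algebra G"
  shows "(\<lambda>x. \<Sum>a\<in>A. f a x) \<in> gen_algebra G"
  using assms
  by (induction A rule: infinite_finite_induct) (auto intro: gen_algebra.intros)

lemma gen_algebra_power:
  assumes "f \<in> gen_algebra G"
  shows "(\<lambda>x. f x ^ m) \<in> gen_algebra G"
  using assms by (induction m) (auto intro: gen_algebra.intros)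

lemma gen_algebra_prod:
  assumes "\<And>a. a \<in> A \<Longrightarrow> f a \<in> gen_algebra G"
  shows "(\<lambda>x. \<Prod>a\<in>A. f a x) \<in> gen_algebra G"
  using assms
  by (induction A rule: infinite_finite_induct) (auto intro: gen_algebra.intros)

text \<open>Unlike \<open>partial_deriv\<close>, this relation asserts differentiability, and it
  constrains \<open>f'\<close> on \<open>S\<close> only.\<close>

definition has_partial_on ::
    "(real^'n::finite) set \<Rightarrow> 'n \<Rightarrow> (real^'n \<Rightarrow> real) \<Rightarrow> (real^'n \<Rightarrow> real) \<Rightarrow> bool" where
  "has_partial_on S i f f' \<longleftrightarrow>
     (\<forall>x\<in>S. ((\<lambda>t. f (x + t *\<^sub>R axis i 1)) has_real_derivative f' x) (at 0))"

text \<open>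
  The weight \<open>w\<close> is \<open>1\<close> for partial derivatives and \<open>x\<^sub>i\<close> for the operators \<open>T\<^sub>i\<close>, which are thus
  handled without division.
\<close>

definition weighted_stable ::
    "(real^'n::finite) set \<Rightarrow> ('n \<Rightarrow> real^'n \<Rightarrow> real) \<Rightarrow> (real^'n \<Rightarrow> real) set \<Rightarrow> bool" where
  "weighted_stable S w G \<longleftrightarrow>
     (\<forall>f\<in>G. \<forall>i. \<exists>h\<in>gen_algebra G. has_partial_on S i f (\<lambda>x. w i x * h x))"

text \<open>The weight factors out of the sum and product rules, so stability need only be checked
  on generators.\<close>

lemma weighted_stableD:
  assumes "weighted_stable S w G" "f \<in> gen_algebra G"
  shows "\<exists>h\<in>gen_algebra G. has_partial_on S i f (\<lambda>x. w i x * h x)"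
  using assms(2)
proof induction
  case (gen f)
  then show ?case using assms(1) by (auto simp: weighted_stable_def)
next
  case (const c)
  have "has_partial_on S i (\<lambda>x. c) (\<lambda>x. w i x * 0)"
    by (simp add: has_partial_on_def)
  then show ?case using gen_algebra.const by (rule bexI)
next
  case (add f h)
  then obtain f' h' where fh: "f' \<in> gen_algebra G" "h' \<in> gen_algebra G"
    "has_partial_on S i f (\<lambda>x. w i x * f' x)" "has_partial_on S i h (\<lambda>x. w i x * h' x)"
    by blast
  have "has_partial_on S i (\<lambda>x. f x + h x) (\<lambda>x. w i x * (f' x + h' x))"
    using fh(3,4) unfolding has_partial_on_def
    by (auto intro!: derivative_eq_intros simp: algebra_simps)
  then show ?case using gen_algebra.add[OF fh(1,2)] by (rule bexI)
next
  case (mult f h)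
  then obtain f' h' where fh: "f' \<in> gen_algebra G" "h' \<in> gen_algebra G"
    "has_partial_on S i f (\<lambda>x. w i x * f' x)" "has_partial_on S i h (\<lambda>x. w i x * h' x)"
    by blast
  have "has_partial_on S i (\<lambda>x. f x * h x) (\<lambda>x. w i x * (f' x * h x + f x * h' x))"
    unfolding has_partial_on_def
  proof
    fix x assume "x \<in> S"
    then have "((\<lambda>t. f (x + t *\<^sub>R axis i 1)) has_real_derivative w i x * f' x) (at 0)"
      "((\<lambda>t. h (x + t *\<^sub>R axis i 1)) has_real_derivative w i x * h' x) (at 0)"
      using fh(3,4) by (auto simp: has_partial_on_def)
    from DERIV_mult[OF this]
    show "((\<lambda>t. f (x + t *\<^sub>R axis i 1) * h (x + t *\<^sub>R axis i 1)) has_real_derivative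
        w i x * (f' x * h x + f x * h' x)) (at 0)"
      by (simp add: algebra_simps)
  qed
  moreover have "(\<lambda>x. f' x * h x + f x * h' x) \<in> gen_algebra G"
    using fh(1,2) mult.hyps by (intro gen_algebra.add gen_algebra.mult)
  ultimately show ?case by (rule bexI)
qed

text \<open>Since (1/q)' = - q'/q^2 is a polynomial in q' and 1/q, adjoining this single inverse
  suffices.\<close>

lemma weighted_stable_insert_inverse:
  assumes "weighted_stable S w G" "q \<in> gen_algebra G" "\<And>x. x \<in> S \<Longrightarrow> q x \<noteq> 0"
  shows "weighted_stable S w (insert (\<lambda>x. inverse (q x)) G)" (is "weighted_stable S w ?H")
  unfolding weighted_stable_def
proof (intro ballI allI)
  fix f i assume "f \<in> ?H"
  have mono: "h \<in> gen_algebra ?H" if "h \<in> gen_algebra G" for h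
    using gen_algebra_mono[OF that] by blast
  from \<open>f \<in> ?H\<close> consider "f \<in> G" | "f = (\<lambda>x. inverse (q x))" by auto
  then show "\<exists>h\<in>gen_algebra ?H. has_partial_on S i f (\<lambda>x. w i x * h x)"
  proof cases
    case 1
    then show ?thesis using assms(1) mono unfolding weighted_stable_def by blast
  next
    case 2
    obtain q' where q': "q' \<in> gen_algebra G" "has_partial_on S i q (\<lambda>x. w i x * q' x)"
      using weighted_stableD[OF assms(1,2)] by blast
    \<comment> \<open>The sign is written as a constant factor and the square as a product, to fit
      the closure rules of \<open>gen_algebra\<close>.\<close>
    let ?h = "\<lambda>x. - 1 * (q' x * (inverse (q x) * inverse (q x)))"
    have "has_partial_on S i f (\<lambda>x. w i x * ?h x)"
      unfolding has_partial_on_def 2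
    proof
      fix x assume x: "x \<in> S"
      then have "((\<lambda>t. q (x + t *\<^sub>R axis i 1)) has_real_derivative w i x * q' x) (at 0)"
        using q'(2) by (auto simp: has_partial_on_def)
      from DERIV_inverse'[OF this]
      show "((\<lambda>t. inverse (q (x + t *\<^sub>R axis i 1))) has_real_derivative w i x * ?h x) (at 0)"
        using assms(3)[OF x] by (simp add: algebra_simps)
    qed
    moreover have "?h \<in> gen_algebra ?H"
      by (intro gen_algebra.mult gen_algebra.const mono[OF q'(1)] gen_algebra.gen insertI1)
    ultimately show ?thesis by (rule bexI)
  qed
qed

section \<open>Continuity and polynomial growth\<close>

lemma continuous_on_gen_algebra:
  assumes "f \<in> gen_algebra G" "\<And>g. g \<in> G \<Longrightarrow> continuous_on S g"
  shows "continuous_on S f"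
  using assms(1) by induction (auto intro: continuous_intros assms(2))

definition poly_growth_on :: "'a::real_normed_vector set \<Rightarrow> ('a \<Rightarrow> real) \<Rightarrow> bool" where
  "poly_growth_on S f \<longleftrightarrow>
     (\<exists>C\<ge>0. \<exists>N::nat. \<forall>x\<in>S. \<bar>f x\<bar> \<le> C * (1 + (norm x)\<^sup>2) ^ N)"

lemma poly_growth_on_gen_algebra:
  assumes "f \<in> gen_algebra G" "\<And>g. g \<in> G \<Longrightarrow> poly_growth_on S g"
  shows "poly_growth_on S f"
  using assms(1)
proof induction
  case (gen f)
  then show ?case by (rule assms(2))
next
  case (const c)
  show ?case unfolding poly_growth_on_def
    by (intro exI[of _ "\<bar>c\<bar>"] exI[of _ "0::nat"] conjI) auto
next
  case (add f h)
  then obtain C N D M where b: "C \<ge> 0" "\<And>x. x \<in> S \<Longrightarrow> \<bar>f x\<bar> \<le> C * (1 + (norm x)\<^sup>2) ^ N"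
    "D \<ge> 0" "\<And>x. x \<in> S \<Longrightarrow> \<bar>h x\<bar> \<le> D * (1 + (norm x)\<^sup>2) ^ M"
    unfolding poly_growth_on_def by metis
  have "\<bar>f x + h x\<bar> \<le> (C + D) * (1 + (norm x)\<^sup>2) ^ (N + M)" if "x \<in> S" for x
  proof -
    have "\<bar>f x + h x\<bar> \<le> C * (1 + (norm x)\<^sup>2) ^ N + D * (1 + (norm x)\<^sup>2) ^ M"
      using b(2,4)[OF that] by linarith
    \<comment> \<open>The base is at least 1, so \<open>N + M\<close> serves as a common exponent
      for both bounds.\<close>
    also have "\<dots> \<le> C * (1 + (norm x)\<^sup>2) ^ (N + M) + D * (1 + (norm x)\<^sup>2) ^ (N + M)"
      using b(1,3) by (intro add_mono mult_left_mono power_increasing) auto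
    finally show ?thesis by (simp add: algebra_simps)
  qed
  then show ?case using b(1,3) unfolding poly_growth_on_def
    by (intro exI[of _ "C + D"] exI[of _ "N + M"] conjI) auto
next
  case (mult f h)
  then obtain C N D M where b: "C \<ge> 0" "\<And>x. x \<in> S \<Longrightarrow> \<bar>f x\<bar> \<le> C * (1 + (norm x)\<^sup>2) ^ N"
    "D \<ge> 0" "\<And>x. x \<in> S \<Longrightarrow> \<bar>h x\<bar> \<le> D * (1 + (norm x)\<^sup>2) ^ M"
    unfolding poly_growth_on_def by metis
  have "\<bar>f x * h x\<bar> \<le> (C * D) * (1 + (norm x)\<^sup>2) ^ (N + M)" if "x \<in> S" for x
    using mult_mono[OF b(2)[OF that] b(4)[OF that]] b(1)
    by (simp add: abs_mult power_add mult_ac)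
  then show ?case using b(1,3) unfolding poly_growth_on_def
    by (intro exI[of _ "C * D"] exI[of _ "N + M"] conjI) auto
qed

lemma poly_growth_on_powi:
  assumes "poly_growth_on S f"
  shows "\<exists>(nk::int) C. C > 0 \<and> (\<forall>x\<in>S. \<bar>(1 + (norm x)\<^sup>2) powi nk * f x\<bar> < C)"
proof -
  obtain C N where b: "C \<ge> 0" "\<And>x. x \<in> S \<Longrightarrow> \<bar>f x\<bar> \<le> C * (1 + (norm x)\<^sup>2) ^ N"
    using assms unfolding poly_growth_on_def by blast
  \<comment> \<open>The bound \<open>C + 1\<close> is positive even if \<open>C = 0\<close> and
    makes the inequality strict.\<close>
  have "\<bar>(1 + (norm x)\<^sup>2) powi (- int N) * f x\<bar> < C + 1" if "x \<in> S" for x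
  proof -
    have p: "(1 + (norm x)\<^sup>2) ^ N > 0"
      by (intro zero_less_power add_pos_nonneg) auto
    then have "\<bar>(1 + (norm x)\<^sup>2) powi (- int N) * f x\<bar> = \<bar>f x\<bar> / (1 + (norm x)\<^sup>2) ^ N"
      by (simp add: power_int_minus abs_mult divide_inverse mult.commute)
    also have "\<dots> \<le> C" using b(2)[OF that] p by (simp add: pos_divide_le_eq)
    finally show ?thesis by simp
  qed
  then show ?thesis using b(1) by (intro exI[of _ "- int N"] exI[of _ "C + 1"]) auto
qed

section \<open>Iterated derivatives\<close>

text \<open>As \<open>S\<close> is open, x + t e_i stays in \<open>S\<close> for small t, so a
  derivative depends only on values in \<open>S\<close>.\<close>

lemma has_partial_on_cong:
  assumes "open S" "\<And>x. x \<in> S \<Longrightarrow> f x = g x" "has_partial_on S i g g'"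
  shows "has_partial_on S i f g'"
  unfolding has_partial_on_def
proof
  fix x assume x: "x \<in> S"
  have "((\<lambda>t. x + t *\<^sub>R axis i 1) \<longlongrightarrow> x + 0 *\<^sub>R axis i 1) (at (0::real))"
    by (intro tendsto_intros)
  then have "\<forall>\<^sub>F t in at 0. x + t *\<^sub>R axis i 1 \<in> S"
    using topological_tendstoD[OF _ assms(1)] x by simp
  then have "\<forall>\<^sub>F t in at 0. f (x + t *\<^sub>R axis i 1) = g (x + t *\<^sub>R axis i 1)"
    by eventually_elim (rule assms(2))
  \<comment> \<open>The filter \<open>at 0\<close> omits t = 0; agreement at that point is agreement
    at x itself.\<close>
  then have "\<forall>\<^sub>F t in nhds 0. f (x + t *\<^sub>R axis i 1) = g (x + t *\<^sub>R axis i 1)"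
    using assms(2)[OF x] by (simp add: eventually_nhds_conv_at)
  then have "((\<lambda>t. f (x + t *\<^sub>R axis i 1)) has_real_derivative g' x) (at 0) \<longleftrightarrow>
      ((\<lambda>t. g (x + t *\<^sub>R axis i 1)) has_real_derivative g' x) (at 0)"
    by (intro DERIV_cong_ev) auto
  with assms(3) x show "((\<lambda>t. f (x + t *\<^sub>R axis i 1)) has_real_derivative g' x) (at 0)"
    by (simp add: has_partial_on_def)
qed

lemma has_partial_on_imp_partial_deriv:
  assumes "has_partial_on S i f f'" "x \<in> S"
  shows "partial_deriv i f x = f' x"
  using assms by (auto simp: has_partial_on_def partial_deriv_def intro!: DERIV_imp_deriv)

text \<open>Each partial derivative again agrees on \<open>S\<close> with an element of the algebra.
  Agreement on \<open>S\<close> is all that is known of \<open>partial_deriv i f\<close>, so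
  \<open>f\<close> is kept apart from \<open>h\<close>.\<close>

lemma Cinfinity_on_gen_algebra:
  assumes "open S" "weighted_stable S (\<lambda>i x. 1) G" "\<And>g. g \<in> G \<Longrightarrow> continuous_on S g"
    and "h \<in> gen_algebra G" "\<And>x. x \<in> S \<Longrightarrow> f x = h x"
  shows "Cinfinity_on S f"
proof -
  have "Ck_on m S f" for m
    using assms(4,5)
  proof (induction m arbitrary: f h)
    case 0
    then show ?case
      using continuous_on_gen_algebra[OF 0(1) assms(3)] continuous_on_cong[of S S f h] by simp
  next
    case (Suc m)
    have "continuous_on S f"
      using continuous_on_gen_algebra[OF Suc.prems(1) assms(3)] continuous_on_cong[of S S f h]
        Suc.prems(2) by simp
    moreover have "(\<forall>x\<in>S. (\<lambda>t. f (x + t *\<^sub>R axis i 1)) field_differentiable (at 0)) \<and>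
        Ck_on m S (partial_deriv i f)" for i
    proof -
      obtain h' where h': "h' \<in> gen_algebra G" "has_partial_on S i h (\<lambda>x. 1 * h' x)"
        using weighted_stableD[OF assms(2) Suc.prems(1)] by blast
      have f: "has_partial_on S i f h'"
        using has_partial_on_cong[OF assms(1) Suc.prems(2) h'(2)] by simp
      show ?thesis
        using f Suc.IH[OF h'(1) has_partial_on_imp_partial_deriv[OF f]]
        by (auto simp: has_partial_on_def field_differentiable_def)
    qed
    ultimately show ?case by simp
  qed
  then show ?thesis by (simp add: Cinfinity_on_def)
qed

section \<open>The operators T_i on the open orthant\<close>

lemma open_orthant_pos: "x \<in> open_orthant \<Longrightarrow> 0 < x $ i"
  by (simp add: open_orthant_def)

lemma open_open_orthant: "open (open_orthant :: (real^'n::finite) set)"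
proof -
  have "open_orthant = (\<Inter>i. {x :: real^'n. 0 < x $ i})"
    by (auto simp: open_orthant_def)
  moreover have "open (\<Inter>i. {x :: real^'n. 0 < x $ i})"
    by (intro open_INT finite ballI open_Collect_less continuous_intros)
  ultimately show ?thesis by simp
qed

text \<open>There x_i is positive, so the factor 1/x_i of T_i cancels the weight x_i.\<close>

lemma T_op_gen_algebra:
  fixes f :: "real^'n::finite \<Rightarrow> real"
  assumes "weighted_stable open_orthant (\<lambda>i x. x $ i) G"
    and "\<exists>h\<in>gen_algebra G. \<forall>x\<in>open_orthant. f x = h x"
  shows "\<exists>h\<in>gen_algebra G. \<forall>x\<in>open_orthant. T_op i f x = h x"
proof -
  obtain h where h: "h \<in> gen_algebra G" "\<And>x. x \<in> open_orthant \<Longrightarrow> f x = h x"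
    using assms(2) by blast
  obtain h' where h': "h' \<in> gen_algebra G" "has_partial_on open_orthant i h (\<lambda>x. x $ i * h' x)"
    using weighted_stableD[OF assms(1) h(1)] by blast
  have f: "has_partial_on open_orthant i f (\<lambda>x. x $ i * h' x)"
    using has_partial_on_cong[OF open_open_orthant h(2) h'(2)] by simp
  have "T_op i f x = h' x" if "x \<in> open_orthant" for x
    using has_partial_on_imp_partial_deriv[OF f that] open_orthant_pos[OF that, of i]
    by (simp add: T_op_def)
  with h'(1) show ?thesis by blast
qed

lemma T_pow_gen_algebra:
  fixes f :: "real^'n::{finite,linorder} \<Rightarrow> real"
  assumes "weighted_stable open_orthant (\<lambda>i x. x $ i) G"
    and "\<exists>h\<in>gen_algebra G. \<forall>x\<in>open_orthant. f x = h x"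
  shows "\<exists>h\<in>gen_algebra G. \<forall>x\<in>open_orthant. T_pow k f x = h x"
proof -
  have pow: "\<exists>h\<in>gen_algebra G. \<forall>x\<in>open_orthant. (T_op i ^^ m) f x = h x"
    if "\<exists>h\<in>gen_algebra G. \<forall>x\<in>open_orthant. f x = h x" for f :: "real^'n::{finite,linorder} \<Rightarrow> real" and i m
    using that
  proof (induction m)
    case (Suc m)
    show ?case
      using T_op_gen_algebra[OF assms(1) Suc.IH[OF Suc.prems]] by simp
  qed simp
  \<comment> \<open>The head of the list acts first, so the induction needs \<open>f\<close>
    arbitrary: its hypothesis is applied to the function already transformed.\<close>
  have "\<exists>h\<in>gen_algebra G. \<forall>x\<in>open_orthant. fold (\<lambda>i. T_op i ^^ k i) is f x = h x" for "is"
    using assms(2)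
  proof (induction "is" arbitrary: f)
    case (Cons i "is")
    show ?case using Cons.IH[OF pow[OF Cons.prems]] by simp
  qed simp
  then show ?thesis by (simp add: T_pow_def)
qed

section \<open>Polynomials with coefficients of one sign\<close>

text \<open>Asking only for the squares makes this usable both for the coordinates and for their
  squares as generators.\<close>

lemma mpoly_eval_square_in_gen_algebra:
  assumes "\<And>i. (\<lambda>x. (x $ i)\<^sup>2) \<in> gen_algebra G"
  shows "(\<lambda>x. mpoly_eval P (square_args x)) \<in> gen_algebra G"
  unfolding mpoly_eval_def monomial_eval_def square_args_def
  by (intro gen_algebra_sum gen_algebra.mult gen_algebra.const gen_algebra_prod)
    (simp add: gen_algebra_power assms)

lemma monomial_eval_zero_right:
  "monomial_eval \<alpha> 0 = (if \<alpha> = 0 then 1 else 0)"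
proof (cases "\<alpha> = 0")
  case False
  then obtain i where "Poly_Mapping.lookup \<alpha> i \<noteq> 0"
    by (metis poly_mapping_eqI lookup_zero)
  then show ?thesis using False
    by (auto simp: monomial_eval_def prod_zero_iff zero_power)
qed (simp add: monomial_eval_def)

lemma mpoly_eval_zero_right: "mpoly_eval Q 0 = Poly_Mapping.lookup Q 0"
  by (simp add: mpoly_eval_def monomial_eval_zero_right in_keys_iff if_distrib cong: if_cong)

text \<open>On the closed orthant the terms cannot cancel, so |Q(y)| is the sum of their absolute
  values, which is at least that of the constant term.\<close>

lemma same_sign_coeffs_abs_ge:
  assumes "same_sign_coeffs Q" "y \<in> closed_orthant"
  shows "\<bar>mpoly_eval Q y\<bar> \<ge> \<bar>mpoly_eval Q 0\<bar>"
proof (cases "Poly_Mapping.lookup Q 0 = 0")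
  \<comment> \<open>A nonzero constant term puts the exponent 0 into the keys, so it occurs in the
    sum.\<close>
  case False
  let ?t = "\<lambda>\<alpha>. Poly_Mapping.lookup Q \<alpha> * monomial_eval \<alpha> y"
  have m: "monomial_eval \<alpha> y \<ge> 0" for \<alpha>
    using assms(2) by (auto simp: monomial_eval_def closed_orthant_def intro!: prod_nonneg)
  have "\<bar>mpoly_eval Q 0\<bar> = \<bar>?t 0\<bar>"
    by (simp add: mpoly_eval_zero_right monomial_eval_def)
  also have "\<dots> \<le> (\<Sum>\<alpha>\<in>Poly_Mapping.keys Q. \<bar>?t \<alpha>\<bar>)"
    using False by (intro member_le_sum) (auto simp: in_keys_iff)
  also have "\<dots> = \<bar>mpoly_eval Q y\<bar>"
    using assms(1) unfolding same_sign_coeffs_def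
  proof
    assume "\<forall>\<alpha>. Poly_Mapping.lookup Q \<alpha> \<ge> 0"
    then have "?t \<alpha> \<ge> 0" for \<alpha> using m by simp
    then show ?thesis unfolding mpoly_eval_def by (simp add: sum_nonneg)
  next
    assume "\<forall>\<alpha>. Poly_Mapping.lookup Q \<alpha> \<le> 0"
    then have "?t \<alpha> \<le> 0" for \<alpha> using m by (simp add: mult_nonpos_nonneg)
    then show ?thesis unfolding mpoly_eval_def
      by (simp add: sum_nonpos abs_of_nonpos sum_negf)
  qed
  finally show ?thesis .
qed (simp add: mpoly_eval_zero_right)

lemma square_args_in_closed_orthant: "square_args x \<in> closed_orthant"
  by (simp add: square_args_def closed_orthant_def)

section \<open>Coordinates and their squares as generators\<close>

lemma has_partial_on_component:
  "has_partial_on S i (\<lambda>x. x $ j) (\<lambda>x. if i = j then 1 else 0)"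
  unfolding has_partial_on_def
  by (auto simp: axis_def intro!: derivative_eq_intros)

lemma has_partial_on_component_square:
  "has_partial_on S i (\<lambda>x. (x $ j)\<^sup>2) (\<lambda>x. x $ i * (if i = j then 2 else 0))"
  unfolding has_partial_on_def
  by (auto simp: axis_def intro!: derivative_eq_intros)

lemma weighted_stable_components:
  "weighted_stable S (\<lambda>i x. 1) (range (\<lambda>j x. x $ j))"
  unfolding weighted_stable_def
  using has_partial_on_component gen_algebra.const by fastforce

text \<open>T_i maps x_j^2 to a constant, whereas T_i x_i = 1/x_i is unbounded near x_i = 0; hence
  squares as generators.\<close>

lemma weighted_stable_component_squares:
  "weighted_stable S (\<lambda>i x. x $ i) (range (\<lambda>j x. (x $ j)\<^sup>2))"
  unfolding weighted_stable_def
  using has_partial_on_component_square gen_algebra.const by fast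

lemma poly_growth_on_component_square:
  "poly_growth_on S (\<lambda>x::real^'n::finite. (x $ j)\<^sup>2)"
proof -
  have "\<bar>(x $ j)\<^sup>2\<bar> \<le> 1 * (1 + (norm x)\<^sup>2) ^ 1" for x :: "real^'n"
    using power_mono[OF component_le_norm_cart[of x j], of 2] by simp
  then show ?thesis unfolding poly_growth_on_def by (metis zero_le_one)
qed

theorem lemma3p2:
  fixes P Q :: "('n::{finite,linorder}, real) mpoly"
  assumes "\<forall>x\<in>closed_orthant. mpoly_eval Q x \<noteq> 0"
    and "same_sign_coeffs Q"
  shows "(\<lambda>x. mpoly_eval P (square_args x) / mpoly_eval Q (square_args x)) \<in> space_O"
proof -
  define p q where "p = (\<lambda>x. mpoly_eval P (square_args x))"
    and "q = (\<lambda>x. mpoly_eval Q (square_args x))"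
  \<comment> \<open>\<open>X\<close> serves smoothness (weight 1), \<open>X2\<close> the operators
    T_i (weight x_i).\<close>
  define X :: "(real^'n::{finite,linorder} \<Rightarrow> real) set" where "X = range (\<lambda>j x. x $ j)"
  define X2 :: "(real^'n::{finite,linorder} \<Rightarrow> real) set" where "X2 = range (\<lambda>j x. (x $ j)\<^sup>2)"
  let ?g = "\<lambda>x. inverse (q x)"
  have nz: "q x \<noteq> 0" if "x \<in> open_orthant" for x
    using assms(1) square_args_in_closed_orthant by (auto simp: q_def)
  have sqX: "(\<lambda>x. (x $ i)\<^sup>2) \<in> gen_algebra X" for i
    by (intro gen_algebra_power gen_algebra.gen) (simp add: X_def)
  have sqX2: "(\<lambda>x. (x $ i)\<^sup>2) \<in> gen_algebra X2" for i
    by (intro gen_algebra.gen) (simp add: X2_def)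
  have quot: "(\<lambda>x. p x * ?g x) \<in> gen_algebra (insert ?g G)"
    if "\<And>i. (\<lambda>x. (x $ i)\<^sup>2) \<in> gen_algebra G" for G
    unfolding p_def
    by (intro gen_algebra.mult gen_algebra.gen insertI1 subset_insertI
        gen_algebra_mono[OF mpoly_eval_square_in_gen_algebra[OF that]])

  have qX: "q \<in> gen_algebra X"
    unfolding q_def using mpoly_eval_square_in_gen_algebra[OF sqX] .
  have contX: "continuous_on open_orthant f" if "f \<in> X" for f
    using that by (auto simp: X_def intro: continuous_intros)
  have "continuous_on open_orthant ?g"
    using continuous_on_gen_algebra[OF qX contX] nz by (intro continuous_on_inverse) auto
  then have cont: "continuous_on open_orthant f" if "f \<in> insert ?g X" for f
    using that contX by blast
  have stableX: "weighted_stable open_orthant (\<lambda>i x. 1) (insert ?g X)"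
    using weighted_stable_components qX nz unfolding X_def
    by (rule weighted_stable_insert_inverse)
  have smooth: "Cinfinity_on open_orthant (\<lambda>x. p x * ?g x)"
    by (rule Cinfinity_on_gen_algebra[OF open_open_orthant stableX cont quot[OF sqX] refl])

  have qX2: "q \<in> gen_algebra X2"
    unfolding q_def using mpoly_eval_square_in_gen_algebra[OF sqX2] .
  \<comment> \<open>The origin lies in the closed orthant, so the constant term is nonzero.\<close>
  have Q0: "\<bar>mpoly_eval Q 0\<bar> > 0"
    using assms(1) by (simp add: closed_orthant_def)
  \<comment> \<open>Boundedness of 1/q, put as growth with exponent 0.\<close>
  have "\<bar>?g x\<bar> \<le> inverse \<bar>mpoly_eval Q 0\<bar> * (1 + (norm x)\<^sup>2) ^ 0" for x
    using le_imp_inverse_le[OF same_sign_coeffs_abs_ge[OF assms(2) square_args_in_closed_orthant] Q0]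
    by (simp add: q_def)
  then have "poly_growth_on open_orthant ?g"
    unfolding poly_growth_on_def using Q0 by (metis abs_ge_zero inverse_nonnegative_iff_nonnegative)
  then have growth: "poly_growth_on open_orthant f" if "f \<in> insert ?g X2" for f
    using that poly_growth_on_component_square by (auto simp: X2_def)
  have stableX2: "weighted_stable open_orthant (\<lambda>i x. x $ i) (insert ?g X2)"
    using weighted_stable_component_squares qX2 nz unfolding X2_def
    by (rule weighted_stable_insert_inverse)
  \<comment> \<open>On the orthant \<open>T_pow k\<close> of the quotient agrees with an element of
    the algebra, whose generators all have polynomial growth.\<close>
  have "poly_growth_on open_orthant (T_pow k (\<lambda>x. p x * ?g x))" for k
  proof -
    obtain h where h: "h \<in> gen_algebra (insert ?g X2)"
      "\<forall>x\<in>open_orthant. T_pow k (\<lambda>x. p x * ?g x) x = h x"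
      using T_pow_gen_algebra[OF stableX2 bexI[OF ballI[OF refl] quot[OF sqX2]]] by blast
    with poly_growth_on_gen_algebra[OF h(1) growth] show ?thesis
      by (simp add: poly_growth_on_def)
  qed
  from poly_growth_on_powi[OF this] have "(\<lambda>x. p x * ?g x) \<in> space_O"
    unfolding space_O_def using smooth by blast
  then show ?thesis by (simp add: p_def q_def divide_inverse)
qed

end
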